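(* There exists a sequence $(\mathcal{H}_i)$ of 4-uniform 2-hypertrees, where $\mathcal{H}_i$ has $n_i$ vertices and $e_i$ edges, with $n_i\to\infty$ and $e_i/\binom{n_i}{3}\to \frac{2}{7}$.
   Context: A $k$-uniform hypergraph $\mathcal{H}=(V,\mathcal{E})$ consists of a finite vertex set $V$ and a set $\mathcal{E}$ of $k$-element subsets of $V$ (no multiple edges). A $k$-uniform hypergraph is a chain if there is a sequence $v_1,\dots,v_l$ of its vertices in which every vertex appears at least once (possibly more times), $v_1\ne v_l$, and its edge set consists of exactly the $l-k+1$ distinct sets $\{v_i,\dots,v_{i+k-1}\}$, $1\le i\le l-k+1$; it is a semicycle if the same holds with $v_1=v_l$ instead. The length of a chain is its number of edges. $\mathcal{H}$ is chain-connected if every pair of distinct vertices is contained in some subhypergraph that is a chain; semicycle-free if no subhypergraph is a semicycle. A hypertree is a chain-connected, semicycle-free $k$-uniform hypergraph; a 2-hypertree is a hypertree in which every chain (subhypergraph) has length at most 2. *)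

theory Defs
  imports Complex_Main
begin

record 'a hypergraph =
  verts :: "'a set"
  edges :: "'a set set"

definition uniform_hypergraph :: "nat \<Rightarrow> 'a hypergraph \<Rightarrow> bool" where
  "uniform_hypergraph k H \<longleftrightarrow>
     finite (verts H) \<and> (\<forall>e \<in> edges H. e \<subseteq> verts H \<and> card e = k)"

definition subhypergraph :: "'a hypergraph \<Rightarrow> 'a hypergraph \<Rightarrow> bool" where
  "subhypergraph G H \<longleftrightarrow> verts G \<subseteq> verts H \<and> edges G \<subseteq> edges H"

text \<open>With the sequence indexed from 0, this is the set of the \<open>k\<close> consecutive
  terms starting at position \<open>i\<close>.\<close>

definition window :: "nat \<Rightarrow> 'a list \<Rightarrow> nat \<Rightarrow> 'a set" where
  "window k vs i = {vs ! j | j. i \<le> j \<and> j < i + k}"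

text \<open>The condition \<open>k \<le> length vs\<close> says that there is at least one window; injectivity
  says that the \<open>length vs - k + 1\<close> windows are pairwise distinct. The windows have \<open>k\<close>
  elements each because they are edges of a \<open>k\<close>-uniform hypergraph.\<close>

definition window_sequence :: "nat \<Rightarrow> 'a hypergraph \<Rightarrow> 'a list \<Rightarrow> bool" where
  "window_sequence k H vs \<longleftrightarrow>
     k \<le> length vs \<and> set vs = verts H \<and>
     inj_on (window k vs) {0..length vs - k} \<and>
     edges H = window k vs ` {0..length vs - k}"

definition chain :: "nat \<Rightarrow> 'a hypergraph \<Rightarrow> bool" where
  "chain k H \<longleftrightarrow>
     uniform_hypergraph k H \<and> (\<exists>vs. window_sequence k H vs \<and> hd vs \<noteq> last vs)"

definition semicycle :: "nat \<Rightarrow> 'a hypergraph \<Rightarrow> bool" where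
  "semicycle k H \<longleftrightarrow>
     uniform_hypergraph k H \<and> (\<exists>vs. window_sequence k H vs \<and> hd vs = last vs)"

definition chain_connected :: "nat \<Rightarrow> 'a hypergraph \<Rightarrow> bool" where
  "chain_connected k H \<longleftrightarrow>
     (\<forall>x \<in> verts H. \<forall>y \<in> verts H. x \<noteq> y \<longrightarrow>
        (\<exists>C. subhypergraph C H \<and> chain k C \<and> x \<in> verts C \<and> y \<in> verts C))"

definition semicycle_free :: "nat \<Rightarrow> 'a hypergraph \<Rightarrow> bool" where
  "semicycle_free k H \<longleftrightarrow> \<not> (\<exists>S. subhypergraph S H \<and> semicycle k S)"

definition hypertree :: "nat \<Rightarrow> 'a hypergraph \<Rightarrow> bool" where
  "hypertree k H \<longleftrightarrow>
     uniform_hypergraph k H \<and> chain_connected k H \<and> semicycle_free k H"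

definition chain_length :: "'a hypergraph \<Rightarrow> nat" where
  "chain_length C = card (edges C)"

definition bounded_hypertree :: "nat \<Rightarrow> nat \<Rightarrow> 'a hypergraph \<Rightarrow> bool" where
  "bounded_hypertree l k H \<longleftrightarrow>
     hypertree k H \<and> (\<forall>C. subhypergraph C H \<and> chain k C \<longrightarrow> chain_length C \<le> l)"

end

theory Submission
  imports Defs
begin

text \<open>If any two triples that an edge shares with other edges coincide, then three edges in a row
  cannot form a chain or a semicycle. Take the naturals below \<open>6 \<cdot> 3\<^sup>k\<close> with the Steiner triple system
  of lines of the affine geometry over the field with three elements (base 3 digits as
  coordinates), and as edges the sets \<open>L \<union> {s}\<close> where \<open>s\<close> branches off, in the tree of base 3
  prefixes, before the points of the line \<open>L\<close> separate. Every triple other than the \<open>O(n\<^sup>2)\<close> lines lies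
  in at most one edge, since it determines \<open>s\<close> and two points of \<open>L\<close>. So each edge uses up three
  triples, and the density tends to at least \<open>11/36 > 2/7\<close>. The condition is inherited by
  subsets of the edge set, so edges can be removed down to density \<open>2/7\<close>, keeping for each pair
  of vertices one edge that contains it.\<close>

section \<open>A criterion for 4-uniform 2-hypertrees\<close>

lemma window_4: "window 4 vs i = {vs ! i, vs ! (i+1), vs ! (i+2), vs ! (i+3)}"
proof -
  have "{j. i \<le> j \<and> j < i + 4} = {i, i+1, i+2, i+3}" by auto
  moreover have "window 4 vs i = (!) vs ` {j. i \<le> j \<and> j < i + 4}"
    unfolding window_def by auto
  ultimately show ?thesis by simp
qed

lemma card_4_distinct:
  assumes "card {a, b, c, d} = 4"
  shows "distinct [a, b, c, d]"
proof -
  have "card (set [a, b, c, d]) = length [a, b, c, d]" using assms by simp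
  then show ?thesis by (rule card_distinct)
qed

text \<open>From six terms on, the second window meets its neighbours in the triples
  \<open>{b, c, d}\<close> and \<open>{c, d, e}\<close>, which \<open>star\<close> would equate. The
  end points are left free, so chains and semicycles are both covered.\<close>

lemma window_sequence_length_le_5:
  assumes unif: "uniform_hypergraph 4 G" and ws: "window_sequence 4 G vs"
    and star: "\<And>e e1 e2. \<lbrakk>e \<in> edges G; e1 \<in> edges G; e2 \<in> edges G;
       card (e \<inter> e1) = 3; card (e \<inter> e2) = 3\<rbrakk> \<Longrightarrow> e \<inter> e1 = e \<inter> e2"
  shows "length vs \<le> 5"
proof (rule ccontr)
  assume "\<not> length vs \<le> 5"
  then have len: "6 \<le> length vs" by simp
  define W where "W = window 4 vs"
  define a b c d e f
    where "a = vs ! 0" and "b = vs ! 1" and "c = vs ! 2" and "d = vs ! 3"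
      and "e = vs ! 4" and "f = vs ! 5"
  have inE: "W 0 \<in> edges G" "W 1 \<in> edges G" "W 2 \<in> edges G"
    using ws len unfolding window_sequence_def W_def by auto
  have "inj_on W {0..length vs - 4}"
    using ws unfolding window_sequence_def W_def by simp
  then have ne: "W 0 \<noteq> W 1" "W 1 \<noteq> W 2"
    using len by (auto dest: inj_onD)
  have W: "W 0 = {a, b, c, d}" "W 1 = {b, c, d, e}" "W 2 = {c, d, e, f}"
    unfolding W_def window_4 a_def b_def c_def d_def e_def f_def
    by (simp_all add: numeral_eq_Suc)
  have "card (W i) = 4" if "W i \<in> edges G" for i
    using unif that unfolding uniform_hypergraph_def by auto
  note card = this[OF inE(1)] this[OF inE(2)] this[OF inE(3)]
  have dist: "distinct [a, b, c, d]" "distinct [b, c, d, e]" "distinct [c, d, e, f]"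
    by (rule card_4_distinct[OF card(1)[unfolded W]] card_4_distinct[OF card(2)[unfolded W]]
        card_4_distinct[OF card(3)[unfolded W]])+
  \<comment> \<open>Vertices may recur in the sequence, but \<open>a = e\<close> would make the
    first two windows the same set.\<close>
  have "a \<noteq> e" using ne(1) W by auto
  then have 1: "W 1 \<inter> W 0 = {b, c, d}" using W dist by auto
  have "b \<noteq> f" using ne(2) W by auto
  then have 2: "W 1 \<inter> W 2 = {c, d, e}" using W dist by auto
  have "card (W 1 \<inter> W 0) = 3" "card (W 1 \<inter> W 2) = 3"
    unfolding 1 2 using dist by auto
  then have "{b, c, d} = {c, d, e}" using star[OF inE(2,1,3)] 1 2 by simp
  then show False using dist by auto
qed

lemma edge_chain:
  assumes "uniform_hypergraph 4 H" "e \<in> edges H"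
  shows "chain 4 \<lparr>verts = e, edges = {e}\<rparr>"
proof -
  have "card e = 4" using assms unfolding uniform_hypergraph_def by auto
  then have fin: "finite e" by (metis card.infinite zero_neq_numeral)
  then obtain vs where vs: "set vs = e" "distinct vs" using finite_distinct_list by blast
  then have len: "length vs = 4" using \<open>card e = 4\<close> distinct_card by fastforce
  then obtain a b c d where abcd: "vs = [a, b, c, d]"
    by (auto simp: numeral_eq_Suc length_Suc_conv)
  have "window_sequence 4 \<lparr>verts = e, edges = {e}\<rparr> vs"
    unfolding window_sequence_def using vs(1) unfolding abcd by (simp add: window_4)
  moreover have "hd vs \<noteq> last vs" using vs abcd by auto
  moreover have "uniform_hypergraph 4 \<lparr>verts = e, edges = {e}\<rparr>"
    unfolding uniform_hypergraph_def using fin \<open>card e = 4\<close> by auto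
  ultimately show ?thesis unfolding chain_def by blast
qed

text \<open>Single edges serve as connecting chains. With at most 5 terms a chain has at most 2
  windows. A semicycle of 4 terms would repeat a vertex inside an edge, and one of 5 terms would
  have two equal windows.\<close>

lemma bounded_hypertree_2_4I:
  assumes unif: "uniform_hypergraph 4 H"
    and pairs: "\<And>x y. \<lbrakk>x \<in> verts H; y \<in> verts H; x \<noteq> y\<rbrakk> \<Longrightarrow> \<exists>e\<in>edges H. x \<in> e \<and> y \<in> e"
    and star: "\<And>e e1 e2. \<lbrakk>e \<in> edges H; e1 \<in> edges H; e2 \<in> edges H;
       card (e \<inter> e1) = 3; card (e \<inter> e2) = 3\<rbrakk> \<Longrightarrow> e \<inter> e1 = e \<inter> e2"
  shows "bounded_hypertree 2 4 H"
proof -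
  have len: "length vs \<le> 5"
    if "subhypergraph G H" "uniform_hypergraph 4 G" "window_sequence 4 G vs" for G vs
    using that(2,3)
  proof (rule window_sequence_length_le_5)
    show "e \<inter> e1 = e \<inter> e2"
      if "e \<in> edges G" "e1 \<in> edges G" "e2 \<in> edges G" "card (e \<inter> e1) = 3" "card (e \<inter> e2) = 3"
      for e e1 e2
      using star that \<open>subhypergraph G H\<close> unfolding subhypergraph_def by blast
  qed
  have "chain_connected 4 H"
    unfolding chain_connected_def
  proof (intro ballI impI)
    fix x y assume "x \<in> verts H" "y \<in> verts H" "x \<noteq> y"
    then obtain e where e: "e \<in> edges H" "x \<in> e" "y \<in> e" using pairs by blast
    moreover have "subhypergraph \<lparr>verts = e, edges = {e}\<rparr> H"
      using e unif unfolding subhypergraph_def uniform_hypergraph_def by auto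
    ultimately show "\<exists>C. subhypergraph C H \<and> chain 4 C \<and> x \<in> verts C \<and> y \<in> verts C"
      using edge_chain[OF unif e(1)] by force
  qed
  moreover have "semicycle_free 4 H"
    unfolding semicycle_free_def
  proof
    assume "\<exists>S. subhypergraph S H \<and> semicycle 4 S"
    then obtain S vs where S: "subhypergraph S H" "uniform_hypergraph 4 S"
        "window_sequence 4 S vs" "hd vs = last vs"
      unfolding semicycle_def by blast
    have ge: "4 \<le> length vs" using S(3) unfolding window_sequence_def by simp
    have "window 4 vs 0 \<in> edges S" using S(3) unfolding window_sequence_def by auto
    then have "card (window 4 vs 0) = 4" using S(2) unfolding uniform_hypergraph_def by auto
    then have dist: "distinct [vs ! 0, vs ! 1, vs ! 2, vs ! 3]"
      using window_4[of vs 0] card_4_distinct by (metis add_0)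
    have eq: "vs ! 0 = vs ! (length vs - 1)"
      using S(4) ge by (metis hd_conv_nth last_conv_nth list.size(3) not_numeral_le_zero)
    have "length vs \<noteq> 4" using dist eq by auto
    then have l5: "length vs = 5" using len[OF S(1-3)] ge by linarith
    then have "vs ! 0 = vs ! 4" using eq by simp
    then have "window 4 vs 0 = window 4 vs 1"
      unfolding window_4 by (auto simp: numeral_eq_Suc)
    moreover have "inj_on (window 4 vs) {0..1}"
      using S(3) l5 unfolding window_sequence_def by simp
    ultimately show False by (auto dest: inj_onD)
  qed
  moreover have "chain_length C \<le> 2" if C: "subhypergraph C H" "chain 4 C" for C
  proof -
    obtain vs where vs: "uniform_hypergraph 4 C" "window_sequence 4 C vs"
      using C(2) unfolding chain_def by blast
    have "edges C = window 4 vs ` {0..length vs - 4}"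
      using vs(2) unfolding window_sequence_def by simp
    then have "card (edges C) \<le> card {0..length vs - 4}"
      by (metis card_image_le finite_atLeastAtMost)
    then show ?thesis using len[OF C(1) vs] unfolding chain_length_def by simp
  qed
  ultimately show ?thesis
    using unif unfolding bounded_hypertree_def hypertree_def by blast
qed

section \<open>The digitwise affine triple system\<close>

text \<open>Reading naturals in base 3, \<open>third x y\<close> is the point collinear with \<open>x\<close> and \<open>y\<close> in the
  affine geometry over the field with three elements: \<open>-(x + y)\<close> digit by digit, without carry.\<close>

function third :: "nat \<Rightarrow> nat \<Rightarrow> nat" where
  "third x y = (if x = 0 \<and> y = 0 then 0
     else 3 * third (x div 3) (y div 3) + (2 * (x + y)) mod 3)"
  by auto
termination by (relation "measure (\<lambda>(x, y). x + y)") auto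

declare third.simps [simp del]

text \<open>With \<open>third_mod_3\<close>, this replaces the recursive equation: identities for
  \<open>third\<close> are then checked on the last digit and, by induction, on the rest.\<close>

lemma third_div_3: "third x y div 3 = third (x div 3) (y div 3)"
  by (subst third.simps) (simp add: third.simps[of 0 0])

lemma third_mod_3: "third x y mod 3 = (2 * (x + y)) mod 3"
  by (subst third.simps) simp

lemma third_0_0 [simp]: "third 0 0 = 0"
  by (simp add: third.simps)

lemma eq_by_div_mod_3: "\<lbrakk>x div 3 = y div 3; x mod 3 = y mod 3\<rbrakk> \<Longrightarrow> x = (y::nat)"
  by (metis div_mult_mod_eq)

lemma third_same [simp]: "third x x = x"
proof (induction x rule: less_induct)
  case (less x)
  show ?case
  proof (cases "x = 0")
    case False
    show ?thesis
    proof (rule eq_by_div_mod_3)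
      show "third x x div 3 = x div 3" unfolding third_div_3 using False less by simp
      show "third x x mod 3 = x mod 3" unfolding third_mod_3 by presburger
    qed
  qed simp
qed

lemma third_commute: "third x y = third y x"
proof (induction x y rule: third.induct)
  case (1 x y)
  show ?case
  proof (cases "x = 0 \<and> y = 0")
    case False
    show ?thesis
    proof (rule eq_by_div_mod_3)
      show "third x y div 3 = third y x div 3" unfolding third_div_3 by (rule 1[OF False])
      show "third x y mod 3 = third y x mod 3" unfolding third_mod_3 by (simp only: add.commute)
    qed
  qed simp
qed

text \<open>In each digit, \<open>-(x - (x + y)) = y\<close> modulo 3.\<close>

lemma third_third [simp]: "third x (third x y) = y"
proof (induction x y rule: third.induct)
  case (1 x y)
  show ?case
  proof (cases "x = 0 \<and> y = 0")
    case False
    have mod: "(2 * (x + z)) mod 3 = (2 * (x + z mod 3)) mod 3" for z :: nat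
      by (metis mod_add_right_eq mod_mult_right_eq)
    show ?thesis
    proof (rule eq_by_div_mod_3)
      show "third x (third x y) div 3 = y div 3" unfolding third_div_3 by (rule 1[OF False])
      have "third x (third x y) mod 3 = (2 * (x + (2 * (x + y)) mod 3)) mod 3"
        by (subst third_mod_3, subst mod, subst third_mod_3) (rule refl)
      also have "\<dots> = (2 * (x + 2 * (x + y))) mod 3" by (rule mod[symmetric])
      also have "2 * (x + 2 * (x + y)) = y + 3 * (2 * x + y)" by simp
      also have "\<dots> mod 3 = y mod 3" by (rule mod_mult_self2)
      finally show "third x (third x y) mod 3 = y mod 3" .
    qed
  qed simp
qed

text \<open>This links lines to the prefix tree: if two points of a line share a prefix, so does the
  third.\<close>

lemma third_div_power: "third x y div 3 ^ j = third (x div 3 ^ j) (y div 3 ^ j)"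
proof (induction j)
  case (Suc j)
  have Suc_div: "z div 3 ^ Suc j = z div 3 ^ j div 3" for z :: nat
    by (simp only: power_Suc2 div_mult2_eq)
  show ?case unfolding Suc_div Suc.IH third_div_3 ..
qed simp

lemma third_eq_left_iff: "third x y = x \<longleftrightarrow> x = y"
  by (metis third_same third_third)

lemma third_eq_right_iff: "third x y = y \<longleftrightarrow> x = y"
  using third_eq_left_iff[of y x] by (auto simp: third_commute)

section \<open>Lines form a Steiner triple system\<close>

definition line :: "nat \<Rightarrow> nat \<Rightarrow> nat set" where
  "line x y = {x, y, third x y}"

lemma card_line: "x \<noteq> y \<Longrightarrow> card (line x y) = 3"
  unfolding line_def using third_eq_left_iff[of x y] third_eq_right_iff[of x y] by auto

text \<open>The four identities, with \<open>third_third\<close>, give the third point for every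
  ordered pair of points of the line.\<close>

lemma line_eq:
  assumes "p \<in> line x y" "q \<in> line x y" "p \<noteq> q"
  shows "line p q = line x y"
proof -
  have 1: "third y x = third x y" by (rule third_commute)
  have 2: "third (third x y) x = y" using third_commute[of "third x y" x] by simp
  have 3: "third y (third x y) = x" using third_third[of y x] 1 by simp
  have 4: "third (third x y) y = x" using third_commute[of "third x y" y] 3 by simp
  from 1 2 3 4 show ?thesis using assms unfolding line_def by auto
qed

section \<open>The quadruples and their common triples\<close>

text \<open>In terms of the 3-adic tree (leading digits at the root), \<open>s\<close> branches off before \<open>x\<close> and
  \<open>y\<close> separate. As the tree is an ultrametric space, a triple has at most one such \<open>s\<close>.\<close>

definition branches_off :: "nat \<Rightarrow> nat \<Rightarrow> nat \<Rightarrow> bool" where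
  "branches_off x y s \<longleftrightarrow> (\<exists>j. x div 3 ^ j = y div 3 ^ j \<and> x div 3 ^ j \<noteq> s div 3 ^ j)"

lemma div_power_mono:
  assumes "x div 3 ^ i = y div 3 ^ i" "i \<le> j"
  shows "x div 3 ^ j = y div (3 ^ j :: nat)"
proof -
  have "z div 3 ^ j = z div 3 ^ i div 3 ^ (j - i)" for z :: nat
    using assms(2) by (simp add: div_mult2_eq[symmetric] power_add[symmetric])
  then show ?thesis using assms(1) by simp
qed

text \<open>Of the two levels, take the coarser: both agreements hold there by
  \<open>div_power_mono\<close>, against the disagreement at that level.\<close>

lemma branches_off_unique:
  assumes "branches_off x y s"
  shows "\<not> branches_off y s x"
proof
  assume "branches_off y s x"
  then obtain i where i: "y div 3 ^ i = s div 3 ^ i" "y div 3 ^ i \<noteq> x div 3 ^ i"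
    unfolding branches_off_def by blast
  obtain j where j: "x div 3 ^ j = y div 3 ^ j" "x div 3 ^ j \<noteq> s div 3 ^ j"
    using assms unfolding branches_off_def by blast
  show False
    using div_power_mono[OF i(1), of j] div_power_mono[OF j(1), of i] i(2) j by linarith
qed

lemma branches_off_commute: "branches_off x y s \<Longrightarrow> branches_off y x s"
  unfolding branches_off_def by force

lemma branches_off_line:
  assumes "branches_off x y s" "p \<in> line x y" "q \<in> line x y"
  shows "branches_off p q s"
proof -
  obtain j where j: "x div 3 ^ j = y div 3 ^ j" "x div 3 ^ j \<noteq> s div 3 ^ j"
    using assms(1) unfolding branches_off_def by auto
  then have "r div 3 ^ j = x div 3 ^ j" if "r \<in> line x y" for r
    using that unfolding line_def by (auto simp: third_div_power)
  then have "p div 3 ^ j = q div 3 ^ j \<and> p div 3 ^ j \<noteq> s div 3 ^ j" using assms j(2) by simp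
  then show ?thesis unfolding branches_off_def by blast
qed

text \<open>Otherwise \<open>s\<close> would branch off from the pair \<open>s\<close>,
  \<open>s\<close>.\<close>

lemma branches_off_notin_line: "branches_off x y s \<Longrightarrow> s \<notin> line x y"
  using branches_off_line[of x y s s s] unfolding branches_off_def by blast

lemma triple_in_quad_cases:
  assumes "x \<noteq> y" "branches_off x y s" "t \<subseteq> insert s (line x y)" "card t = 3"
  obtains "t = line x y"
  | p q where "t = {p, q, s}" "p \<noteq> q" "branches_off p q s" "line p q = line x y"
proof (cases "s \<in> t")
  case False
  then have "t \<subseteq> line x y" using assms(3) by auto
  then have "t = line x y"
    using card_subset_eq[of "line x y" t] card_line[OF assms(1)] assms(4)
    by (simp add: line_def)
  then show ?thesis using that by blast
next
  case True
  then have "card (t - {s}) = 2" using assms(4) by simp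
  then obtain p q where pq: "t - {s} = {p, q}" "p \<noteq> q" by (auto simp: card_2_iff)
  then have "p \<in> line x y" "q \<in> line x y" using assms(3) by auto
  moreover have "t = {p, q, s}" using pq True by auto
  ultimately show ?thesis
    using that pq(2) branches_off_line[OF assms(2)] line_eq by blast
qed

lemma branching_triple_not_line:
  assumes "p \<noteq> q" "branches_off p q s"
  shows "{p, q, s} \<noteq> line x y"
proof
  assume "{p, q, s} = line x y"
  then have "p \<in> line x y" "q \<in> line x y" "s \<in> line x y" by blast+
  moreover from this have "line p q = line x y" using assms(1) by (intro line_eq)
  ultimately show False using branches_off_notin_line[OF assms(2)] by simp
qed

text \<open>If \<open>s\<close> and \<open>s'\<close> differed, one triple would have two branching
  points, which \<open>branches_off_unique\<close> excludes. So the other two points agree as a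
  pair, and they span the line.\<close>

lemma branching_triple_unique:
  assumes pq: "p \<noteq> q" "branches_off p q s"
    and pq': "p' \<noteq> q'" "branches_off p' q' s'"
    and eq: "{p, q, s} = {p', q', s'}"
  shows "s = s' \<and> line p q = line p' q'"
proof -
  have notin: "s \<noteq> p" "s \<noteq> q" "s' \<noteq> p'" "s' \<noteq> q'"
    using branches_off_notin_line[OF pq(2)] branches_off_notin_line[OF pq'(2)]
    unfolding line_def by auto
  note branch = pq(2) branches_off_commute[OF pq(2)] pq'(2) branches_off_commute[OF pq'(2)]
  have "s = s'"
  proof (rule ccontr)
    assume "s \<noteq> s'"
    then have "s' = p \<or> s' = q" "s = p' \<or> s = q'" using eq by auto
    then have "p = s' \<and> (s = p' \<and> q = q' \<or> s = q' \<and> q = p')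
        \<or> q = s' \<and> (s = p' \<and> p = q' \<or> s = q' \<and> p = p')"
      using eq pq(1) pq'(1) notin by auto
    then show False using branch branches_off_unique by metis
  qed
  have "{p, q} = {p, q, s} - {s}" "{p', q'} = {p', q', s'} - {s'}" using notin by auto
  then have "{p, q} = {p', q'}" using eq \<open>s = s'\<close> by simp
  then have "p \<in> {p', q'}" "q \<in> {p', q'}" by blast+
  then have "p \<in> line p' q'" "q \<in> line p' q'" unfolding line_def by auto
  then have "line p q = line p' q'" using pq(1) by (rule line_eq)
  then show ?thesis using \<open>s = s'\<close> by simp
qed

text \<open>A triple is either a line or has a branching point, never both, so the mixed cases
  vanish. In either case the triple determines the line of the quadruple.\<close>

lemma common_triple:
  assumes xy: "x \<noteq> y" "branches_off x y s" "t \<subseteq> insert s (line x y)" "card t = 3"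
    and xy': "x' \<noteq> y'" "branches_off x' y' s'" "t \<subseteq> insert s' (line x' y')"
  shows "line x y = line x' y' \<and> (t = line x y \<or> s = s')"
proof -
  note cases' = triple_in_quad_cases[OF xy' xy(4)]
  from xy show ?thesis
  proof (cases rule: triple_in_quad_cases)
    case 1
    show ?thesis
    proof (rule cases')
      assume "t = line x' y'"
      then show ?thesis using 1 by simp
    next
      fix p q assume "t = {p, q, s'}" "p \<noteq> q" "branches_off p q s'"
      then show ?thesis using 1 branching_triple_not_line[of p q s' x y] by simp
    qed
  next
    case (2 p q)
    show ?thesis
    proof (rule cases')
      assume "t = line x' y'"
      then show ?thesis using 2(1) branching_triple_not_line[OF 2(2,3)] by simp
    next
      fix p' q' assume "t = {p', q', s'}" "p' \<noteq> q'" "branches_off p' q' s'" "line p' q' = line x' y'"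
      then show ?thesis using branching_triple_unique[OF 2(2,3), of p' q' s'] 2(1,4) by simp
    qed
  qed
qed

text \<open>The third point of the line is bounded only later, in \<open>quad_subset\<close>, where
  \<open>n\<close> has the form \<open>2 * 3 ^ j\<close>.\<close>

definition flags :: "nat \<Rightarrow> (nat \<times> nat \<times> nat) set" where
  "flags n = {(x, y, s). x < n \<and> y < n \<and> s < n \<and> x \<noteq> y \<and> branches_off x y s}"

definition quad :: "nat \<times> nat \<times> nat \<Rightarrow> nat set" where
  "quad = (\<lambda>(x, y, s). insert s (line x y))"

lemma finite_flags: "finite (flags n)"
  by (rule finite_subset[of _ "{..<n} \<times> {..<n} \<times> {..<n}"]) (auto simp: flags_def)

lemma card_quad: "f \<in> flags n \<Longrightarrow> card (quad f) = 4"
proof -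
  assume "f \<in> flags n"
  then obtain x y s where f: "f = (x, y, s)" "x \<noteq> y" "branches_off x y s"
    unfolding flags_def by auto
  have "finite (line x y)" unfolding line_def by simp
  then have "card (insert s (line x y)) = Suc (card (line x y))"
    using branches_off_notin_line[OF f(3)] by (rule card_insert_disjoint)
  then show ?thesis using card_line[OF f(2)] f(1) unfolding quad_def by simp
qed

text \<open>A triple shared with a different edge must be the line of \<open>e\<close>: otherwise
  line and branching point would agree, and so would the edges.\<close>

lemma quad_star:
  assumes "e \<in> quad ` flags n" "e1 \<in> quad ` flags n" "e2 \<in> quad ` flags n"
    and "card (e \<inter> e1) = 3" "card (e \<inter> e2) = 3"
  shows "e \<inter> e1 = e \<inter> e2"
proof -
  obtain x y s where e: "e = insert s (line x y)" "x \<noteq> y" "branches_off x y s"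
    using assms(1) unfolding flags_def quad_def by auto
  have common: "e \<inter> e' = line x y" if e': "e' \<in> quad ` flags n" "card (e \<inter> e') = 3" for e'
  proof -
    obtain x' y' s' where 1: "e' = insert s' (line x' y')" "x' \<noteq> y'" "branches_off x' y' s'"
      using e'(1) unfolding flags_def quad_def by auto
    have 2: "line x y = line x' y' \<and> (e \<inter> e' = line x y \<or> s = s')"
      by (rule common_triple) (use e 1 e' in auto)
    have "e \<noteq> e'" using e' card_quad assms(1) by fastforce
    then show ?thesis using 1 2 e by auto
  qed
  show ?thesis using common[OF assms(2,4)] common[OF assms(3,5)] by simp
qed

section \<open>Counting\<close>

text \<open>An edge determines its line, hence \<open>s\<close>, and a line has six ordered pairs of points.\<close>

lemma card_flags_le: "card (flags n) \<le> 6 * card (quad ` flags n)"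
proof -
  have fib: "card {f \<in> flags n. quad f = e} \<le> 6" if eq: "e \<in> quad ` flags n" for e
  proof -
    obtain x y s where e: "e = insert s (line x y)" "x \<noteq> y" "branches_off x y s"
      using eq unfolding flags_def quad_def by auto
    define L where "L = line x y"
    have L: "card L = 3" "finite L" using card_line e(2) unfolding L_def line_def by auto
    have "{f \<in> flags n. quad f = e} \<subseteq> (\<lambda>(p, q). (p, q, s)) ` (L \<times> L - (\<lambda>p. (p, p)) ` L)"
    proof
      fix f assume "f \<in> {f \<in> flags n. quad f = e}"
      then obtain x' y' s' where f: "f = (x', y', s')" "x' \<noteq> y'" "branches_off x' y' s'"
          "insert s' (line x' y') = e"
        unfolding flags_def quad_def by auto
      \<comment> \<open>For the triple \<open>line x y\<close> only the first conjunct carries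
        information; \<open>s\<close> is then the one point of \<open>e\<close> outside the
        line.\<close>
      have "line x y = line x' y' \<and> (line x y = line x y \<or> s = s')"
        by (rule common_triple) (use e f card_line in auto)
      moreover from this have "s = s'"
        using e f branches_off_notin_line by (metis insert_ident insertI1 insertE)
      ultimately show "f \<in> (\<lambda>(p, q). (p, q, s)) ` (L \<times> L - (\<lambda>p. (p, p)) ` L)"
        using f unfolding L_def by (auto simp: line_def)
    qed
    then have "card {f \<in> flags n. quad f = e}
        \<le> card ((\<lambda>(p, q). (p, q, s)) ` (L \<times> L - (\<lambda>p. (p, p)) ` L))"
      using L(2) by (intro card_mono) auto
    also have "\<dots> \<le> card (L \<times> L - (\<lambda>p. (p, p)) ` L)"
      using L(2) by (intro card_image_le) auto
    also have "\<dots> = card (L \<times> L) - card ((\<lambda>p. (p, p)) ` L)"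
      using L(2) by (intro card_Diff_subset) auto
    also have "card ((\<lambda>p. (p, p)) ` L) = 3" using L by (simp add: card_image inj_on_def)
    finally show ?thesis using L by simp
  qed
  have "flags n = (\<Union>e \<in> quad ` flags n. {f \<in> flags n. quad f = e})" by auto
  moreover have "card (\<Union>e \<in> quad ` flags n. {f \<in> flags n. quad f = e})
      \<le> (\<Sum>e \<in> quad ` flags n. card {f \<in> flags n. quad f = e})"
    by (rule card_UN_le) (simp add: finite_flags)
  ultimately have "card (flags n) \<le> (\<Sum>e \<in> quad ` flags n. card {f \<in> flags n. quad f = e})"
    by simp
  also have "\<dots> \<le> (\<Sum>e \<in> quad ` flags n. 6)" using fib by (rule sum_mono)
  finally show ?thesis by simp
qed

text \<open>As \<open>c * d\<close> is a multiple of \<open>d\<close>, no block of length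
  \<open>d\<close> is cut off at the end.\<close>

lemma card_div_class:
  assumes "0 < (d::nat)" "x < c * d"
  shows "card {y. y < c * d \<and> y div d = x div d} = d"
proof -
  have "x div d < c" using assms by (simp add: less_mult_imp_div_less)
  then have "x div d * d + d \<le> c * d"
    by (metis add.commute mult_Suc mult_le_mono1 Suc_leI)
  moreover have "y div d = q \<longleftrightarrow> q * d \<le> y \<and> y < q * d + d" for y q
    using assms(1)
    by (metis div_nat_eqI div_times_less_eq_dividend dividend_less_div_times add.commute
        mult_Suc mult.commute)
  ultimately have "y < c * d \<and> y div d = x div d
      \<longleftrightarrow> x div d * d \<le> y \<and> y < x div d * d + d" for y
    by (meson order_less_le_trans)
  then have "{y. y < c * d \<and> y div d = x div d} = {x div d * d ..< x div d * d + d}"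
    unfolding set_eq_iff mem_Collect_eq atLeastLessThan_iff by blast
  then show ?thesis by simp
qed

text \<open>Only the two topmost branchings are counted: into 2 intervals of length \<open>3 ^ (k + 1)\<close>, and
  of each of these into 3 intervals of length \<open>3 ^ k\<close>. They already yield more than \<open>2/7\<close> of the
  number of triples, asymptotically \<open>11/36\<close>.\<close>

lemma card_flags_ge:
  fixes k :: nat
  defines "M \<equiv> 3 ^ k"
  shows "6 * M * ((3 * M - 1) * (3 * M) + (M - 1) * (2 * M)) \<le> card (flags (6 * M))"
proof -
  have M: "0 < M" unfolding M_def by simp
  define C where "C d x = {y. y < 6 * M \<and> y div d = x div d}" for d x
  define U where "U = {..<6 * M}"
  \<comment> \<open>For fixed \<open>x\<close>, the pairs \<open>(y, s)\<close>: in
    \<open>F\<close>, \<open>y\<close> shares the half of \<open>x\<close> and \<open>s\<close> lies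
    in the other half; in \<open>G\<close>, \<open>y\<close> shares the block of length
    \<open>M\<close> and \<open>s\<close> lies elsewhere in the same half.\<close>
  define F where "F x = (C (3 * M) x - {x}) \<times> (U - C (3 * M) x)" for x
  define G where "G x = (C M x - {x}) \<times> (C (3 * M) x - C M x)" for x
  have fin: "finite (C d x)" "finite U" for d x unfolding C_def U_def by auto
  have CM: "C M x \<subseteq> C (3 * M) x" for x
    unfolding C_def by (auto simp: mult.commute[of 3] div_mult2_eq)
  have card: "card (F x \<union> G x) = (3 * M - 1) * (3 * M) + (M - 1) * (2 * M)" if x: "x \<in> U" for x
  proof -
    have c3: "card (C (3 * M) x) = 3 * M"
      using card_div_class[of "3 * M" x 2] x M unfolding C_def U_def by simp
    have c1: "card (C M x) = M"
      using card_div_class[of M x 6] x M unfolding C_def U_def by simp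
    have "x \<in> C (3 * M) x" "x \<in> C M x" using x unfolding C_def U_def by auto
    then have "card (C (3 * M) x - {x}) = 3 * M - 1" "card (C M x - {x}) = M - 1"
      using c1 c3 by simp_all
    moreover have "card (U - C (3 * M) x) = 6 * M - 3 * M"
      using c3 fin by (subst card_Diff_subset) (auto simp: C_def U_def)
    moreover have "card (C (3 * M) x - C M x) = 3 * M - M"
      using c1 c3 fin CM by (subst card_Diff_subset) auto
    ultimately have "card (F x) = (3 * M - 1) * (3 * M)" "card (G x) = (M - 1) * (2 * M)"
      unfolding F_def G_def by (simp_all add: card_cartesian_product)
    moreover have "F x \<inter> G x = {}" unfolding F_def G_def by auto
    ultimately show ?thesis using fin by (simp add: card_Un_disjoint F_def G_def)
  qed
  have sub: "(SIGMA x:U. F x \<union> G x) \<subseteq> flags (6 * M)"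
  proof clarify
    fix x y s assume x: "x \<in> U" and "(y, s) \<in> F x \<union> G x"
    then consider "(y, s) \<in> F x" | "(y, s) \<in> G x" by blast
    then show "(x, y, s) \<in> flags (6 * M)"
    proof cases
      case 1
      then have "x div 3 ^ Suc k = y div 3 ^ Suc k \<and> x div 3 ^ Suc k \<noteq> s div 3 ^ Suc k"
        unfolding F_def C_def U_def M_def by auto
      then show ?thesis
        using 1 x unfolding flags_def branches_off_def F_def C_def U_def by blast
    next
      case 2
      then have "x div 3 ^ k = y div 3 ^ k \<and> x div 3 ^ k \<noteq> s div 3 ^ k"
        unfolding G_def C_def M_def by auto
      then show ?thesis
        using 2 x unfolding flags_def branches_off_def G_def C_def U_def by blast
    qed
  qed
  have "card (SIGMA x:U. F x \<union> G x) = (\<Sum>x\<in>U. card (F x \<union> G x))"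
    using fin by (intro card_SigmaI) (auto simp: F_def G_def)
  also have "\<dots> = 6 * M * ((3 * M - 1) * (3 * M) + (M - 1) * (2 * M))"
    using card by (simp add: U_def)
  finally show ?thesis using card_mono[OF finite_flags sub] by simp
qed

section \<open>Comparison with two sevenths of all triples\<close>

lemma six_times_choose_3: "6 * (Suc (Suc n) choose 3) = Suc (Suc n) * Suc n * n"
proof -
  have "6 * (Suc (Suc n) choose 3) = 2 * (3 * (Suc (Suc n) choose 3))" by simp
  also have "3 * (Suc (Suc n) choose 3) = Suc (Suc n) * (Suc n choose 2)"
    using Suc_times_binomial[of 2 "Suc n"] by (simp add: numeral_eq_Suc)
  also have "2 * (Suc (Suc n) * (Suc n choose 2)) = Suc (Suc n) * (2 * (Suc n choose 2))" by simp
  also have "2 * (Suc n choose 2) = Suc n * n"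
    using Suc_times_binomial[of 1 n] by (simp add: numeral_eq_Suc)
  finally show ?thesis by (simp only: mult.assoc)
qed

lemma two_sevenths_le_card_quads:
  "2 * (6 * 3 ^ k choose 3) \<le> 7 * card (quad ` flags (6 * 3 ^ k))"
proof -
  define M :: nat where "M = 3 ^ k"
  \<comment> \<open>Writing \<open>M = Suc m\<close> removes all truncated subtractions.\<close>
  define m where "m = M - 1"
  have M: "M = Suc m" unfolding m_def M_def by simp
  have "6 * (6 * M choose 3) = (6 * m + 6) * (6 * m + 5) * (6 * m + 4)"
    using six_times_choose_3[of "6 * m + 4"] unfolding M by (simp add: algebra_simps)
  moreover have "(6 * m + 6) * ((3 * m + 2) * (3 * m + 3) + m * (2 * m + 2))
      \<le> 6 * card (quad ` flags (6 * M))"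
    using order_trans[OF card_flags_ge[of k] card_flags_le[of "6 * 3 ^ k"]]
    unfolding M_def[symmetric] M by (simp add: algebra_simps)
  \<comment> \<open>Without the factor \<open>6 * m + 6\<close>, the sides are
    \<open>72 m^2 + 108 m + 40\<close> and \<open>77 m^2 + 119 m + 42\<close>.\<close>
  moreover have "2 * ((6 * m + 6) * (6 * m + 5) * (6 * m + 4))
      \<le> 7 * ((6 * m + 6) * ((3 * m + 2) * (3 * m + 3) + m * (2 * m + 2)))"
    by (simp add: algebra_simps)
  ultimately show ?thesis unfolding M_def[symmetric] by linarith
qed

section \<open>Choosing the right number of edges\<close>

lemma flags_two_blocks:
  assumes "x < 2 * 3 ^ j" "y < 2 * 3 ^ j" "s < 2 * 3 ^ j" "x \<noteq> y"
    and "x div 3 ^ j = y div 3 ^ j" "x div 3 ^ j \<noteq> s div 3 ^ j"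
  shows "(x, y, s) \<in> flags (2 * 3 ^ j)"
proof -
  have "branches_off x y s" unfolding branches_off_def using assms(5,6) by (intro exI[of _ j] conjI)
  then show ?thesis unfolding flags_def using assms(1-4) by simp
qed

text \<open>Leading digits 0 and 1 would give a third point with leading digit 2, out of range. But
  \<open>x\<close> and \<open>s\<close> are separated at level \<open>i\<close>, which forces
  \<open>i \<le> j\<close>, so \<open>x\<close> and \<open>y\<close> lie in the same half, and their
  third point too.\<close>

lemma quad_subset:
  assumes "f \<in> flags (2 * 3 ^ j)"
  shows "quad f \<subseteq> {..<2 * 3 ^ j}"
proof -
  obtain x y s i where f: "f = (x, y, s)" "x < 2 * 3 ^ j" "y < 2 * 3 ^ j" "s < 2 * 3 ^ j"
      "x div 3 ^ i = y div 3 ^ i" "x div 3 ^ i \<noteq> s div 3 ^ i"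
    using assms unfolding flags_def branches_off_def by auto
  have "i \<le> j"
  proof (rule ccontr)
    assume "\<not> i \<le> j"
    then have "(3::nat) ^ Suc j \<le> 3 ^ i" by (intro power_increasing) auto
    then have "x < 3 ^ i" "s < 3 ^ i" using f by auto
    then show False using f(6) by simp
  qed
  then have "third x y div 3 ^ j = x div 3 ^ j"
    using div_power_mono[OF f(5)] by (simp add: third_div_power)
  moreover have "x div 3 ^ j < 2" using f(2) by (simp add: less_mult_imp_div_less)
  ultimately have "third x y div 3 ^ j < 2" by simp
  then have "third x y < 2 * 3 ^ j" by (subst (asm) div_less_iff_less_mult) simp_all
  then show ?thesis using f unfolding quad_def line_def by auto
qed

text \<open>Two points of one half span a line, and any \<open>s\<close> in the other half completes
  it. Otherwise \<open>y\<close> branches off from \<open>x\<close> and a further point of the half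
  of \<open>x\<close>.\<close>

lemma pair_in_quad:
  assumes "0 < j" "x < 2 * 3 ^ j" "y < 2 * 3 ^ j" "x \<noteq> y"
  shows "\<exists>f \<in> flags (2 * 3 ^ j). x \<in> quad f \<and> y \<in> quad f"
proof -
  define N :: nat where "N = 3 ^ j"
  have N: "1 < N" unfolding N_def using assms(1) by (intro one_less_power) auto
  note flag = flags_two_blocks[of _ j, folded N_def]
  have lt: "x < 2 * N" "y < 2 * N" using assms unfolding N_def by simp_all
  show ?thesis
  proof (cases "x div N = y div N")
    case True
    define s where "s = (if x < N then N else 0)"
    have "s < 2 * N" "x div N \<noteq> s div N"
      using N unfolding s_def by (auto simp: div_eq_0_iff)
    then have "(x, y, s) \<in> flags (2 * N)" using flag lt assms(4) True by blast
    then show ?thesis unfolding quad_def line_def N_def by force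
  next
    case False
    define c where "c = (if x < N then 0 else N)"
    \<comment> \<open>One of the first two points of the half of \<open>x\<close>, chosen to differ
      from \<open>x\<close>; \<open>1 < N\<close> keeps it in that half.\<close>
    define z where "z = (if x = c then Suc c else c)"
    have "x div N = c div N" "z div N = c div N"
      using N lt unfolding c_def z_def by (auto intro!: div_nat_eqI)
    moreover have "z < 2 * N" "x \<noteq> z" using N unfolding c_def z_def by auto
    ultimately have "(x, z, y) \<in> flags (2 * N)" using flag lt False by metis
    then show ?thesis unfolding quad_def line_def N_def by force
  qed
qed

text \<open>Leaves room, within the prescribed number of edges, for one edge per ordered pair of
  vertices.\<close>

lemma square_le_two_sevenths_choose_3:
  assumes "2 \<le> k"
  shows "(6 * 3 ^ k)\<^sup>2 \<le> 2 * (6 * 3 ^ k choose 3) div (7::nat)"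
proof -
  define M :: nat where "M = 3 ^ k"
  have "(3::nat) ^ 2 \<le> M" unfolding M_def using assms by (intro power_increasing) auto
  then have "4 \<le> M" by simp
  then obtain m where m: "M = m + 4" using le_Suc_ex by (metis add.commute)
  have "6 * (6 * M choose 3) = (6 * m + 24) * (6 * m + 23) * (6 * m + 22)"
    using six_times_choose_3[of "6 * m + 22"] unfolding m by (simp add: algebra_simps)
  \<comment> \<open>This is tight at \<open>m = 0\<close>, where \<open>21 * 24 = 504\<close> and
    \<open>23 * 22 = 506\<close>.\<close>
  moreover have "21 * (6 * m + 24)\<^sup>2 \<le> (6 * m + 24) * (6 * m + 23) * (6 * m + 22)"
    by (simp add: algebra_simps power2_eq_square)
  moreover have "6 * M = 6 * m + 24" unfolding m by simp
  ultimately have "7 * (6 * M)\<^sup>2 \<le> 2 * (6 * M choose 3)" by simp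
  then show ?thesis
    unfolding M_def[symmetric] by (simp add: less_eq_div_iff_mult_less_eq mult.commute)
qed

lemma exists_bounded_hypertree:
  assumes "2 \<le> k"
  shows "\<exists>H :: nat hypergraph. bounded_hypertree 2 4 H \<and> card (verts H) = 6 * 3 ^ k \<and>
    card (edges H) = 2 * (6 * 3 ^ k choose 3) div 7"
proof -
  define n :: nat where "n = 6 * 3 ^ k"
  have n: "n = 2 * 3 ^ Suc k" unfolding n_def by simp
  define E where "E = quad ` flags n"
  have finE: "finite E" unfolding E_def using finite_flags by blast
  define g where "g = (\<lambda>(x, y). SOME e. e \<in> E \<and> x \<in> e \<and> y \<in> e)"
  define P where "P = {(x, y). x < n \<and> y < n \<and> x \<noteq> y}"
  have g: "g (x, y) \<in> E \<and> x \<in> g (x, y) \<and> y \<in> g (x, y)" if "(x, y) \<in> P" for x y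
  proof -
    have "\<exists>e. e \<in> E \<and> x \<in> e \<and> y \<in> e"
      using pair_in_quad[of "Suc k" x y] that unfolding P_def E_def n by auto
    then show ?thesis unfolding g_def prod.case by (rule someI_ex)
  qed
  \<comment> \<open>These edges are kept to cover all pairs; the others in \<open>E\<close> may be
    dropped freely to reach the exact cardinality.\<close>
  define K where "K = g ` P"
  have KE: "K \<subseteq> E" unfolding K_def using g by auto
  have P_sub: "P \<subseteq> {..<n} \<times> {..<n}" unfolding P_def by auto
  then have "card K \<le> card ({..<n} \<times> {..<n})"
    unfolding K_def by (intro surj_card_le[THEN order_trans, OF _ _ card_mono])
      (auto intro: finite_subset)
  also have "\<dots> = n\<^sup>2" by (simp add: power2_eq_square)
  also have "\<dots> \<le> 2 * (n choose 3) div 7"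
    unfolding n_def by (rule square_le_two_sevenths_choose_3[OF assms])
  finally have "card K \<le> 2 * (n choose 3) div 7" .
  moreover have "2 * (n choose 3) div 7 \<le> card E"
    using two_sevenths_le_card_quads[of k] unfolding E_def n_def by simp
  ultimately obtain F where F: "K \<subseteq> F" "F \<subseteq> E" "card F = 2 * (n choose 3) div 7"
    using exists_subset_between[OF _ _ KE finE] by blast
  define H where "H = \<lparr>verts = {..<n}, edges = F\<rparr>"
  have edges_sub: "edges H \<subseteq> quad ` flags n" using F(2) unfolding H_def E_def by simp
  have "bounded_hypertree 2 4 H"
  proof (rule bounded_hypertree_2_4I)
    show "uniform_hypergraph 4 H"
      unfolding uniform_hypergraph_def
    proof (intro conjI ballI)
      fix e assume "e \<in> edges H"
      then obtain f where "e = quad f" "f \<in> flags n" using F(2) unfolding H_def E_def by auto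
      then show "e \<subseteq> verts H" "card e = 4"
        using quad_subset[of f "Suc k"] card_quad unfolding H_def n by simp_all
    qed (simp add: H_def)
    show "\<exists>e\<in>edges H. x \<in> e \<and> y \<in> e" if "x \<in> verts H" "y \<in> verts H" "x \<noteq> y" for x y
    proof -
      have "(x, y) \<in> P" using that unfolding H_def P_def by simp
      then have "g (x, y) \<in> F" "x \<in> g (x, y) \<and> y \<in> g (x, y)"
        using g F(1) unfolding K_def by blast+
      then show ?thesis unfolding H_def by auto
    qed
    show "e \<inter> e1 = e \<inter> e2"
      if "e \<in> edges H" "e1 \<in> edges H" "e2 \<in> edges H" "card (e \<inter> e1) = 3" "card (e \<inter> e2) = 3"
      for e e1 e2
    proof (rule quad_star[of e n e1 e2])
      show "e \<in> quad ` flags n" "e1 \<in> quad ` flags n" "e2 \<in> quad ` flags n"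
        using that(1-3)[THEN edges_sub[THEN subsetD]] .
    qed (rule that(4,5))+
  qed
  moreover have "card (verts H) = 6 * 3 ^ k" unfolding H_def n_def by simp
  moreover have "card (edges H) = 2 * (6 * 3 ^ k choose 3) div 7"
    using F(3) unfolding H_def n_def by simp
  ultimately show ?thesis by blast
qed

section \<open>Passage to the limit\<close>

lemma tendsto_two_sevenths_floor:
  assumes "filterlim c at_top sequentially"
  shows "(\<lambda>i. real (2 * c i div 7) / real (c i)) \<longlonglongrightarrow> 2 / 7"
proof (rule tendsto_sandwich)
  have c: "filterlim (\<lambda>i. real (c i)) at_top sequentially"
    using assms filterlim_compose filterlim_real_sequentially by blast
  have pos: "\<forall>\<^sub>F i in sequentially. 0 < c i"
    using eventually_compose_filterlim[OF eventually_gt_at_top assms] .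
  show "\<forall>\<^sub>F i in sequentially. 2 / 7 - 1 / real (c i) \<le> real (2 * c i div 7) / real (c i)"
    using pos
  proof eventually_elim
    case (elim i)
    \<comment> \<open>Rounding down costs less than 1, hence at most \<open>1 / c i\<close> in the
      ratio.\<close>
    have "2 * c i \<le> 7 * (2 * c i div 7) + 7" by presburger
    then have "2 * real (c i) / 7 - 1 \<le> real (2 * c i div 7)" by linarith
    then have "(2 * real (c i) / 7 - 1) / real (c i) \<le> real (2 * c i div 7) / real (c i)"
      by (rule divide_right_mono) simp
    then show ?case using elim by (simp add: diff_divide_distrib)
  qed
  show "\<forall>\<^sub>F i in sequentially. real (2 * c i div 7) / real (c i) \<le> 2 / 7"
    using pos
  proof eventually_elim
    case (elim i)
    have "7 * (2 * c i div 7) \<le> 2 * c i" by presburger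
    then have "real (2 * c i div 7) \<le> 2 / 7 * real (c i)" by linarith
    then show ?case using elim by (simp add: pos_divide_le_eq)
  qed
  have "(\<lambda>i. 2 / 7 - 1 / real (c i)) \<longlonglongrightarrow> 2 / 7 - 0"
    by (intro tendsto_intros tendsto_divide_0[OF tendsto_const] filterlim_at_top_imp_at_infinity c)
  then show "(\<lambda>i. 2 / 7 - 1 / real (c i)) \<longlonglongrightarrow> 2 / 7" by simp
qed simp

theorem theorem7:
  "\<exists>H :: nat \<Rightarrow> nat hypergraph.
     (\<forall>i. bounded_hypertree 2 4 (H i)) \<and>
     filterlim (\<lambda>i. card (verts (H i))) at_top sequentially \<and>
     (\<lambda>i. real (card (edges (H i))) / real (card (verts (H i)) choose 3))
       \<longlonglongrightarrow> 2 / 7"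
proof -
  \<comment> \<open>The shift by 2 ensures the exponent bound of
    \<open>exists_bounded_hypertree\<close>.\<close>
  define n :: "nat \<Rightarrow> nat" where "n i = 6 * 3 ^ (i + 2)" for i
  obtain H :: "nat \<Rightarrow> nat hypergraph"
    where H: "bounded_hypertree 2 4 (H i)" "card (verts (H i)) = n i"
      "card (edges (H i)) = 2 * (n i choose 3) div 7" for i
    using exists_bounded_hypertree[of "_ + 2"] unfolding n_def by (metis le_add2)
  have n: "i \<le> n i" for i
  proof -
    have "i < 3 ^ i" by (rule power_gt_expt) simp
    then show ?thesis unfolding n_def by (simp add: power_add)
  qed
  have n_lim: "filterlim n at_top sequentially"
    by (rule filterlim_at_top_mono[OF filterlim_ident]) (simp add: n)
  have "n i \<le> n i choose 3" for i
  proof -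
    have "(n i)\<^sup>2 \<le> 2 * (n i choose 3) div 7"
      unfolding n_def by (rule square_le_two_sevenths_choose_3) simp
    moreover have "n i \<le> (n i)\<^sup>2" by (rule self_le_power) (simp_all add: n_def)
    ultimately show ?thesis by linarith
  qed
  then have c_lim: "filterlim (\<lambda>i. n i choose 3) at_top sequentially"
    by (intro filterlim_at_top_mono[OF n_lim]) simp
  show ?thesis
  proof (intro exI[of _ H] conjI allI)
    show "bounded_hypertree 2 4 (H i)" for i by (rule H(1))
    show "filterlim (\<lambda>i. card (verts (H i))) at_top sequentially"
      unfolding H(2) by (rule n_lim)
    show "(\<lambda>i. real (card (edges (H i))) / real (card (verts (H i)) choose 3)) \<longlonglongrightarrow> 2 / 7"
      unfolding H(2,3) by (rule tendsto_two_sevenths_floor[OF c_lim])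
  qed
qed

end
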